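(* Let $N$ be a triply periodic Steiner network in $\mathbb R^3$ with quotient graph $K_4$, length $L$ and spanned volume $V$. Then $$\frac{L^3}{V}\ \ge\ \frac{27}{\sqrt2},$$ where equality holds if and only if all edge lengths of $N$ coincide and the lattice is body-centred cubic.
   Context: An ($n$-periodic) network $N$ (triply periodic if $n=3$) is a connected simple graph immersed with straight edges of positive length into $\mathbb R^n$ such that: $N$ is invariant under a lattice $\Lambda\subset\mathbb R^n$ of rank $n$, and the quotient $N/\Lambda$ is a finite graph, possibly with loops and multiple edges. "Immersed" means that for each vertex the restriction of the map to the union of the incident edges is injective. The length is $L=L(N/\Lambda)$, the total edge length of the quotient, and the (spanned) volume is $V=V(\mathbb R^n/\Lambda)$. A Steiner network is a network all of whose vertices have degree $3$, such that at each vertex the three unit edge vectors sum to zero (edges are coplanar and meet at $120^\circ$). $K_4$ is the complete graph on four vertices. *)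

theory Defs
  imports "HOL-Analysis.Analysis" "Graph_Theory.Graph_Theory"
begin

section \<open>Lattices\<close>

definition lattice_basis :: "('n::finite \<Rightarrow> real^'n) \<Rightarrow> (real^'n) set \<Rightarrow> bool" where
  "lattice_basis b \<Lambda> \<longleftrightarrow> inj b \<and> independent (range b) \<and>
     \<Lambda> = range (\<lambda>k :: 'n \<Rightarrow> int. \<Sum>i\<in>UNIV. of_int (k i) *\<^sub>R b i)"

definition full_rank_lattice :: "(real^'n::finite) set \<Rightarrow> bool" where
  "full_rank_lattice \<Lambda> \<longleftrightarrow> (\<exists>b. lattice_basis b \<Lambda>)"

text \<open>
  The volume of the torus \<open>\<real>\<^sup>n / \<Lambda>\<close>. By \<open>covolume_eq\<close> below, the value does not depend
  on the basis.
\<close>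

definition covolume :: "(real^'n::finite) set \<Rightarrow> real" where
  "covolume \<Lambda> = (THE v. \<exists>b. lattice_basis b \<Lambda> \<and> v = \<bar>det (\<chi> i. b i)\<bar>)"

lemma det_in_Ints:
  fixes A :: "real^'n::finite^'n"
  assumes "\<And>i j. A $ i $ j \<in> \<int>"
  shows "det A \<in> \<int>"
  unfolding det_def using assms by (intro Ints_sum Ints_mult Ints_prod) auto

lemma lattice_basis_change:
  assumes "lattice_basis b \<Lambda>" "lattice_basis b' \<Lambda>"
  obtains A :: "real^'n::finite^'n"
  where "\<And>i j. A $ i $ j \<in> \<int>" "(\<chi> i. b' i) = A ** (\<chi> i. b i)"
proof -
  have "b' i \<in> \<Lambda>" for i
  proof -
    have "b' i = (\<Sum>j\<in>UNIV. of_int (if j = i then 1 else 0) *\<^sub>R b' j)"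
      by (simp add: if_distrib if_distribR cong: if_cong)
    then show ?thesis
      using assms(2) unfolding lattice_basis_def
      by (auto intro: range_eqI[where x = "\<lambda>j. if j = i then 1 else 0"])
  qed
  then have "\<forall>i. \<exists>k :: 'n \<Rightarrow> int. b' i = (\<Sum>j\<in>UNIV. of_int (k j) *\<^sub>R b j)"
    using assms(1) unfolding lattice_basis_def by blast
  then obtain K :: "'n \<Rightarrow> 'n \<Rightarrow> int"
    where K: "\<And>i. b' i = (\<Sum>j\<in>UNIV. of_int (K i j) *\<^sub>R b j)"
    by metis
  show thesis
  proof (rule that[of "\<chi> i j. of_int (K i j)"])
    show "(\<chi> i. b' i) = (\<chi> i j. of_int (K i j)) ** (\<chi> i. b i)"
      by (simp add: vec_eq_iff matrix_matrix_mult_def K)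
  qed auto
qed

lemma lattice_basis_abs_det_unique:
  assumes b: "lattice_basis b \<Lambda>" and b': "lattice_basis b' \<Lambda>"
  shows "\<bar>det (\<chi> i. b i)\<bar> = \<bar>det (\<chi> i. b' i)\<bar>"
proof -
  have le: "\<bar>det (\<chi> i. b i)\<bar> \<le> \<bar>det (\<chi> i. b' i)\<bar>"
    if bb': "lattice_basis b \<Lambda>" "lattice_basis b' \<Lambda>" for b b' :: "'a \<Rightarrow> real^'a"
  proof -
    obtain A :: "real^'a^'a" where A: "\<And>i j. A $ i $ j \<in> \<int>"
      "(\<chi> i. b' i) = A ** (\<chi> i. b i)"
      using lattice_basis_change[OF bb'] by blast
    obtain C :: "real^'a^'a" where C: "(\<chi> i. b i) = C ** (\<chi> i. b' i)"
      using lattice_basis_change[OF bb'(2,1)] by blast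
    have eq: "det (\<chi> i. b i) = det C * (det A * det (\<chi> i. b i))"
      using A(2) C by (metis det_mul)
    show ?thesis
    proof (cases "det (\<chi> i. b i) = 0")
      case False
      then have "det A \<noteq> 0"
        using eq by auto
      then have "1 \<le> \<bar>det A\<bar>"
        using det_in_Ints[OF A(1)] by (metis Ints_nonzero_abs_ge1)
      then have "1 * \<bar>det (\<chi> i. b i)\<bar> \<le> \<bar>det A\<bar> * \<bar>det (\<chi> i. b i)\<bar>"
        by (intro mult_right_mono) auto
      then show ?thesis
        by (simp add: A(2) det_mul abs_mult)
    qed simp
  qed
  show ?thesis
    using le[OF b b'] le[OF b' b] by simp
qed

lemma covolume_eq:
  assumes "lattice_basis b \<Lambda>"
  shows "covolume \<Lambda> = \<bar>det (\<chi> i. b i)\<bar>"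
  unfolding covolume_def
  using assms lattice_basis_abs_det_unique by (intro the_equality) blast+

text \<open>
  The conventional body-centred cubic lattice consists of the corners and the centres of the unit
  cubes. Being body-centred cubic is a property up to similarity.
\<close>

definition standard_bcc :: "(real^3) set" where
  "standard_bcc = {x. (\<forall>i. x $ i \<in> \<int>) \<or> (\<forall>i. x $ i - 1/2 \<in> \<int>)}"

definition body_centred_cubic :: "(real^3) set \<Rightarrow> bool" where
  "body_centred_cubic \<Lambda> \<longleftrightarrow>
     (\<exists>c f. c > 0 \<and> orthogonal_transformation f \<and> \<Lambda> = (\<lambda>x. c *\<^sub>R f x) ` standard_bcc)"

section \<open>Periodic networks\<close>

text \<open>
  A simple graph is a symmetric loop-free digraph \<open>N\<close>, whose arcs are pairs of vertices: each
  undirected edge \<open>{u, v}\<close> is represented by the two arcs \<open>(u, v)\<close> and \<open>(v, u)\<close>. The graph is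
  abstract and \<open>pos\<close> need not be injective on vertices, since a network is only immersed. A point
  of the union of the edges at \<open>v\<close> is given by a neighbour \<open>w\<close> and a parameter \<open>t \<in> [0, 1]\<close>,
  where all \<open>(w, 0)\<close> denote the vertex \<open>v\<close> itself.
\<close>

definition immersed_at :: "'v pair_pre_digraph \<Rightarrow> ('v \<Rightarrow> real^'n::finite) \<Rightarrow> 'v \<Rightarrow> bool" where
  "immersed_at N pos v \<longleftrightarrow>
     (\<forall>w w' t t'. (v, w) \<in> parcs N \<and> (v, w') \<in> parcs N \<and> t \<in> {0..1} \<and> t' \<in> {0..1} \<and>
        (1 - t) *\<^sub>R pos v + t *\<^sub>R pos w = (1 - t') *\<^sub>R pos v + t' *\<^sub>R pos w' \<longrightarrow>
        (t = 0 \<and> t' = 0) \<or> (w = w' \<and> t = t'))"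

text \<open>
  As the network is immersed rather than embedded, invariance under \<open>\<Lambda>\<close> is an action
  of \<open>\<Lambda>\<close> on the abstract graph for which \<open>pos\<close> is equivariant.
\<close>

definition vertex_orbit ::
  "(real^'n::finite) set \<Rightarrow> (real^'n \<Rightarrow> 'v \<Rightarrow> 'v) \<Rightarrow> 'v \<Rightarrow> 'v set" where
  "vertex_orbit \<Lambda> act v = (\<lambda>x. act x v) ` \<Lambda>"

definition arc_orbit ::
  "(real^'n::finite) set \<Rightarrow> (real^'n \<Rightarrow> 'v \<Rightarrow> 'v) \<Rightarrow> 'v \<times> 'v \<Rightarrow> ('v \<times> 'v) set" where
  "arc_orbit \<Lambda> act e = (\<lambda>x. (act x (fst e), act x (snd e))) ` \<Lambda>"

text \<open>
  The quotient graph, which may have loops and parallel arcs. The end points of an orbit of arcs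
  are the orbits of its tails and of its heads. Distinct orientations of an edge lie in distinct
  orbits, because no lattice translation can swap the two end points of an edge.
\<close>

definition quotient_graph ::
  "'v pair_pre_digraph \<Rightarrow> (real^'n::finite) set \<Rightarrow> (real^'n \<Rightarrow> 'v \<Rightarrow> 'v)
     \<Rightarrow> ('v set, ('v \<times> 'v) set) pre_digraph" where
  "quotient_graph N \<Lambda> act =
     \<lparr> verts = vertex_orbit \<Lambda> act ` pverts N,
       arcs = arc_orbit \<Lambda> act ` parcs N,
       tail = image fst,
       head = image snd \<rparr>"

definition edge_length :: "('v \<Rightarrow> real^'n::finite) \<Rightarrow> 'v \<times> 'v \<Rightarrow> real" where
  "edge_length pos e = dist (pos (fst e)) (pos (snd e))"

locale periodic_network = pair_bidirected_digraph N
  for N :: "'v pair_pre_digraph" +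
  fixes pos :: "'v \<Rightarrow> real^'n::finite"
    and \<Lambda> :: "(real^'n) set"
    and act :: "real^'n \<Rightarrow> 'v \<Rightarrow> 'v"
  assumes connected_graph: "Digraph_Component.connected (with_proj N)"
    and pos_edge_length: "e \<in> parcs N \<Longrightarrow> edge_length pos e > 0"
    and immersed: "v \<in> pverts N \<Longrightarrow> immersed_at N pos v"
    and lattice: "full_rank_lattice \<Lambda>"
    and act_verts: "\<lbrakk>x \<in> \<Lambda>; v \<in> pverts N\<rbrakk> \<Longrightarrow> act x v \<in> pverts N"
    and act_zero: "v \<in> pverts N \<Longrightarrow> act 0 v = v"
    and act_add: "\<lbrakk>x \<in> \<Lambda>; y \<in> \<Lambda>; v \<in> pverts N\<rbrakk> \<Longrightarrow> act (x + y) v = act x (act y v)"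
    and act_arcs: "\<lbrakk>x \<in> \<Lambda>; (u, v) \<in> parcs N\<rbrakk> \<Longrightarrow> (act x u, act x v) \<in> parcs N"
    and pos_act: "\<lbrakk>x \<in> \<Lambda>; v \<in> pverts N\<rbrakk> \<Longrightarrow> pos (act x v) = pos v + x"
    and finite_quotient: "fin_digraph (quotient_graph N \<Lambda> act)"

text \<open>
  All arcs in an orbit have the same length, so \<open>the_elem\<close> is applied to a singleton. The
  factor \<open>1/2\<close> compensates for counting both orientations of each edge.
\<close>

definition quotient_length ::
  "'v pair_pre_digraph \<Rightarrow> ('v \<Rightarrow> real^'n::finite) \<Rightarrow> (real^'n) set \<Rightarrow> (real^'n \<Rightarrow> 'v \<Rightarrow> 'v) \<Rightarrow> real" where
  "quotient_length N pos \<Lambda> act =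
     (\<Sum>a \<in> arcs (quotient_graph N \<Lambda> act). the_elem (edge_length pos ` a)) / 2"

lemma (in periodic_network) edge_length_orbit:
  assumes "e \<in> parcs N"
  shows "the_elem (edge_length pos ` arc_orbit \<Lambda> act e) = edge_length pos e"
proof -
  obtain b where "lattice_basis b \<Lambda>"
    using lattice unfolding full_rank_lattice_def by blast
  then have "\<Lambda> \<noteq> {}"
    unfolding lattice_basis_def by blast
  moreover have "edge_length pos (act x (fst e), act x (snd e)) = edge_length pos e"
    if "x \<in> \<Lambda>" for x
    using that assms arc_fst_in_verts arc_snd_in_verts
    by (simp add: edge_length_def pos_act)
  ultimately have "edge_length pos ` arc_orbit \<Lambda> act e = {edge_length pos e}"
    unfolding arc_orbit_def image_image by auto
  then show ?thesis
    by simp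
qed

locale steiner_network = periodic_network +
  assumes degree_three: "v \<in> pverts N \<Longrightarrow> out_degree (with_proj N) v = 3"
    and balanced: "v \<in> pverts N \<Longrightarrow> (\<Sum>w | (v, w) \<in> parcs N. sgn (pos w - pos v)) = 0"

end

theory Submission
  imports Defs
begin

text \<open>
  The balancing condition at the four vertices of \<open>K\<^sub>4\<close> determines all inner products of the unit
  edge vectors: those of a triangle \<open>p, q, r\<close> meet pairwise at \<open>60\<close> degrees, and the other three are
  \<open>r - p\<close>, \<open>p - q\<close>, \<open>q - r\<close>. The lattice is generated by the three triangles through the fourth
  vertex; in the basis \<open>p, q, r\<close> these form the reduced Laplacian of \<open>K\<^sub>4\<close> weighted by the edge
  lengths. By Kirchhoff, \<open>V = T / sqrt 2\<close> with \<open>T\<close> the weighted number of spanning trees, and the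
  claim becomes \<open>27 * T \<le> 2 * L^3\<close>, with equality only for equal weights.
\<close>

section \<open>Spanning trees of the weighted complete graph\<close>

text \<open>The determinant of the reduced Laplacian, where the edges \<open>a\<close> and \<open>a'\<close> (etc.) are opposite.\<close>

definition K4_trees :: "real \<Rightarrow> real \<Rightarrow> real \<Rightarrow> real \<Rightarrow> real \<Rightarrow> real \<Rightarrow> real" where
  "K4_trees a b c a' b' c' =
     (a + b' + c') * ((b + c' + a') * (c + a' + b') - a' * a')
       - c' * (c' * (c + a' + b') + a' * b') - b' * (a' * c' + b' * (b + c' + a'))"

text \<open>Twice the gap is the sum of the terms \<open>6 * P1\<close>, \<open>6 * P2\<close>,
  \<open>6 * P3\<close> and \<open>S\<close>, all nonnegative because they are squares of
  differences with positive weights. In the equality case each of them vanishes, which makes the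
  variables equal.\<close>

lemma amgm3:
  fixes x y z :: real
  assumes "x > 0" "y > 0" "z > 0"
  shows "27 * (x * y * z) \<le> (x + y + z) ^ 3"
    and "27 * (x * y * z) = (x + y + z) ^ 3 \<Longrightarrow> x = y \<and> y = z"
proof -
  define P1 P2 P3 where P: "P1 = x * (y - z)\<^sup>2" "P2 = y * (z - x)\<^sup>2" "P3 = z * (x - y)\<^sup>2"
  define S where "S = (x + y + z) * ((y - z)\<^sup>2 + (z - x)\<^sup>2 + (x - y)\<^sup>2)"
  have R: "2 * ((x + y + z) ^ 3 - 27 * (x * y * z)) = 6 * P1 + 6 * P2 + 6 * P3 + S"
    by (simp add: P S_def power2_eq_square power3_eq_cube algebra_simps)
  have nn: "P1 \<ge> 0" "P2 \<ge> 0" "P3 \<ge> 0" "S \<ge> 0"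
    using assms by (auto simp: P S_def)
  then show "27 * (x * y * z) \<le> (x + y + z) ^ 3"
    using R by argo
  assume "27 * (x * y * z) = (x + y + z) ^ 3"
  then have "6 * P1 + 6 * P2 + 6 * P3 + S = 0"
    using R by argo
  then have "P1 = 0" "P3 = 0"
    using nn by linarith+
  then show "x = y \<and> y = z"
    using assms by (simp add: P)
qed

text \<open>Expanding the determinant leaves one positive monomial for each of the sixteen spanning
  trees of a weighted K_4 in which \<open>a\<close>, \<open>b\<close>, \<open>c\<close> form a star
  and \<open>a'\<close>, \<open>b'\<close>, \<open>c'\<close> the triangle opposite its
  centre.\<close>

lemma K4_trees_pos:
  assumes "a > 0" "b > 0" "c > 0" "a' > 0" "b' > 0" "c' > 0"
  shows "K4_trees a b c a' b' c' > 0"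
proof -
  have "K4_trees a b c a' b' c' =
      a*b*c + a*b*a' + a*b*b' + a*c*a' + a*c*c' + a*a'*b' + a*a'*c' + a*b'*c' +
      b*c*b' + b*c*c' + b*a'*b' + b*a'*c' + b*b'*c' + c*a'*b' + c*a'*c' + c*b'*c'"
    unfolding K4_trees_def by (simp add: algebra_simps)
  moreover have "\<dots> > 0"
    using assms by (intro add_pos_pos mult_pos_pos)
  ultimately show ?thesis
    by simp
qed

text \<open>
  In terms of the sums \<open>s\<close> and differences \<open>d\<close> of opposite weights, \<open>4 * T\<close> is the determinant of
  the symmetric matrix with diagonal \<open>s2 + s3, s1 + s3, s1 + s2\<close> and off-diagonal entries \<open>d\<close> up
  to sign. Its diagonal product is bounded by AM-GM, and the rest is nonpositive as \<open>\<bar>d\<bar> \<le> s\<close>.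
\<close>

lemma K4_trees_le:
  assumes "a > 0" "b > 0" "c > 0" "a' > 0" "b' > 0" "c' > 0"
  shows "27 * K4_trees a b c a' b' c' \<le> 2 * (a + b + c + a' + b' + c') ^ 3"
    and "27 * K4_trees a b c a' b' c' = 2 * (a + b + c + a' + b' + c') ^ 3 \<Longrightarrow>
      a = b \<and> b = c \<and> c = a' \<and> a' = b' \<and> b' = c'"
proof -
  define s1 s2 s3 where s: "s1 = a + a'" "s2 = b + b'" "s3 = c + c'"
  define d1 d2 d3 where d: "d1 = a - a'" "d2 = b - b'" "d3 = c - c'"
  define E where "E = d1\<^sup>2 * (s2 + s3) + d2\<^sup>2 * (s1 + s3) + d3\<^sup>2 * (s1 + s2) - 2 * d1 * d2 * d3"
  have spos: "s1 > 0" "s2 > 0" "s3 > 0"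
    using assms by (auto simp: s)
  have T: "4 * K4_trees a b c a' b' c' = (s2 + s3) * (s1 + s3) * (s1 + s2) - E"
    unfolding K4_trees_def E_def s d by (simp add: power2_eq_square algebra_simps)
  \<comment> \<open>The mixed product in \<open>E\<close> is the only term without a sign. It is
    absorbed by the parts of the first two terms that carry \<open>s3\<close>; what remains still
    contains every squared difference with a positive factor, as the equality case requires.\<close>
  have "\<bar>d3\<bar> \<le> s3"
    using assms by (auto simp: s d)
  moreover have "2 * \<bar>d1 * d2\<bar> \<le> d1\<^sup>2 + d2\<^sup>2"
    using sum_squares_bound[of "\<bar>d1\<bar>" "\<bar>d2\<bar>"] by (simp add: abs_mult)
  ultimately have "\<bar>d3\<bar> * (2 * \<bar>d1 * d2\<bar>) \<le> s3 * (d1\<^sup>2 + d2\<^sup>2)"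
    using spos by (intro mult_mono) auto
  moreover have "2 * d1 * d2 * d3 \<le> \<bar>d3\<bar> * (2 * \<bar>d1 * d2\<bar>)"
    using abs_ge_self[of "2 * d1 * d2 * d3"] by (simp add: abs_mult mult_ac)
  ultimately have E_ge: "d1\<^sup>2 * s2 + d2\<^sup>2 * s1 + d3\<^sup>2 * (s1 + s2) \<le> E"
    unfolding E_def by (simp add: algebra_simps)
  have nn: "d1\<^sup>2 * s2 \<ge> 0" "d2\<^sup>2 * s1 \<ge> 0" "d3\<^sup>2 * (s1 + s2) \<ge> 0"
    using spos by auto
  \<comment> \<open>The trace is twice the total weight. So AM-GM bounds 27 times the diagonal
    product by 8 times the cube of the total, and division by the 4 in \<open>T\<close> gives the
    constant 2.\<close>
  have L: "((s2 + s3) + (s1 + s3) + (s1 + s2)) ^ 3 = 8 * (a + b + c + a' + b' + c') ^ 3"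
  proof -
    have "(s2 + s3) + (s1 + s3) + (s1 + s2) = 2 * (a + b + c + a' + b' + c')"
      by (simp add: s)
    then show ?thesis
      by (simp only: power_mult_distrib) simp
  qed
  have amgm: "27 * ((s2 + s3) * (s1 + s3) * (s1 + s2)) \<le> 8 * (a + b + c + a' + b' + c') ^ 3"
    using amgm3(1)[of "s2 + s3" "s1 + s3" "s1 + s2"] spos unfolding L by simp
  show "27 * K4_trees a b c a' b' c' \<le> 2 * (a + b + c + a' + b' + c') ^ 3"
    using T amgm E_ge nn by linarith
  assume eq: "27 * K4_trees a b c a' b' c' = 2 * (a + b + c + a' + b' + c') ^ 3"
  then have "E = 0" and eq': "27 * ((s2 + s3) * (s1 + s3) * (s1 + s2)) = 8 * (a + b + c + a' + b' + c') ^ 3"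
    using T amgm E_ge nn by linarith+
  then have "d1\<^sup>2 * s2 = 0" "d2\<^sup>2 * s1 = 0" "d3\<^sup>2 * (s1 + s2) = 0"
    using E_ge nn by linarith+
  then have "d1 = 0" "d2 = 0" "d3 = 0"
    using spos by auto
  moreover have "s2 + s3 = s1 + s3 \<and> s1 + s3 = s1 + s2"
    using amgm3(2)[of "s2 + s3" "s1 + s3" "s1 + s2"] spos eq' unfolding L by simp
  ultimately show "a = b \<and> b = c \<and> c = a' \<and> a' = b' \<and> b' = c'"
    using s d by auto
qed

section \<open>Edge vectors and the body-centred cubic lattice\<close>

lemma sum_ordered_pairs_of_four:
  fixes f :: "'a \<Rightarrow> 'a \<Rightarrow> 'b::comm_monoid_add"
  assumes "distinct [p, q, r, s]"
  shows "(\<Sum>(x, y) | x \<in> {p, q, r, s} \<and> y \<in> {p, q, r, s} \<and> x \<noteq> y. f x y) =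
    f p q + f q p + f q r + f r q + f r p + f p r +
    f r s + f s r + f p s + f s p + f q s + f s q"
proof -
  have "{(x, y). x \<in> {p, q, r, s} \<and> y \<in> {p, q, r, s} \<and> x \<noteq> y} =
    {(p, q), (q, p), (q, r), (r, q), (r, p), (p, r), (r, s), (s, r), (p, s), (s, p), (q, s), (s, q)}"
    using assms by auto
  moreover have "p \<noteq> q" "p \<noteq> r" "p \<noteq> s" "q \<noteq> r" "q \<noteq> s" "r \<noteq> s"
    using assms by simp_all
  ultimately show ?thesis
    by (simp add: add.assoc)
qed

text \<open>Taking squared norms in \<open>z = - (x + y)\<close> gives
  \<open>1 = 2 + 2 * (x \<bullet> y)\<close>, the angle of 120 degrees.\<close>

lemma inner_balanced_units:
  fixes x y z :: "'a::real_inner"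
  assumes "norm x = 1" "norm y = 1" "norm z = 1" "x + y + z = 0"
  shows "x \<bullet> y = - 1 / 2"
proof -
  have "z = - (x + y)"
    using assms(4) by (metis add.commute eq_neg_iff_add_eq_0)
  then have "z \<bullet> z = (x + y) \<bullet> (x + y)"
    by (simp only: inner_minus_left inner_minus_right minus_minus)
  moreover have "x \<bullet> x = 1" "y \<bullet> y = 1" "z \<bullet> z = 1"
    using assms by (simp_all add: dot_square_norm)
  ultimately show ?thesis
    by (simp add: inner_add_left inner_add_right inner_commute)
qed

text \<open>The squared determinant is the Gram determinant, here with diagonal entries 1 and all
  other entries 1/2. This is the source of the \<open>sqrt 2\<close> in the bound.\<close>

lemma det_rows_squared:
  fixes p q r :: "real^3"
  assumes "norm p = 1" "norm q = 1" "norm r = 1"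
    and "p \<bullet> q = 1 / 2" "q \<bullet> r = 1 / 2" "r \<bullet> p = 1 / 2"
  shows "(det (vector [p, q, r] :: real^3^3))\<^sup>2 = 1 / 2"
proof -
  let ?P = "vector [p, q, r] :: real^3^3"
  have "?P ** transpose ?P = (\<chi> i j. row i ?P \<bullet> row j ?P)"
    by (simp add: vec_eq_iff matrix_matrix_mult_def transpose_def row_def inner_vec_def)
  also have "det \<dots> = 1 / 2"
    by (simp add: det_3 row_def vec_lambda_eta dot_square_norm assms inner_commute[of q p]
        inner_commute[of r q] inner_commute[of p r])
  finally show ?thesis
    by (simp add: det_mul det_transpose power2_eq_square)
qed

text \<open>The rows are the triangle vectors of the network. Their coordinates in \<open>p\<close>,
  \<open>q\<close>, \<open>r\<close> form \<open>?W\<close>, a reduced Laplacian whose vertices are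
  the triangles: a length shared by two rows appears negated off the diagonal, while
  \<open>a\<close>, \<open>b\<close>, \<open>c\<close> lead to the deleted vertex.\<close>

lemma det_K4_cycles:
  fixes p q r :: "real^3"
  shows "det (vector [(a + b' + c') *\<^sub>R p - c' *\<^sub>R q - b' *\<^sub>R r,
                 (b + c' + a') *\<^sub>R q - c' *\<^sub>R p - a' *\<^sub>R r,
                 (c + a' + b') *\<^sub>R r - b' *\<^sub>R p - a' *\<^sub>R q] :: real^3^3)
       = K4_trees a b c a' b' c' * det (vector [p, q, r] :: real^3^3)" (is "det ?G = _")
proof -
  let ?W = "vector [vector [a + b' + c', - c', - b'], vector [- c', b + c' + a', - a'],
    vector [- b', - a', c + a' + b']] :: real^3^3"
  have "?G = ?W ** vector [p, q, r]"
    by (simp add: vec_eq_iff forall_3 matrix_matrix_mult_def sum_3)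
  moreover have "det ?W = K4_trees a b c a' b' c'"
    unfolding K4_trees_def by (simp add: det_3 algebra_simps)
  ultimately show ?thesis
    by (simp add: det_mul)
qed

section \<open>Lattices spanned by three vectors\<close>

lemma range_triple_combination:
  fixes g1 g2 g3 :: "real^3"
  shows "range (\<lambda>k :: 3 \<Rightarrow> int. \<Sum>i\<in>UNIV. of_int (k i) *\<^sub>R (vector [g1, g2, g3] :: real^3^3) $ i)
    = {of_int k1 *\<^sub>R g1 + of_int k2 *\<^sub>R g2 + of_int k3 *\<^sub>R g3 | k1 k2 k3. True}" (is "?L = ?R")
proof
  show "?L \<subseteq> ?R"
    by (auto simp: sum_3)
  show "?R \<subseteq> ?L"
  proof
    fix x assume "x \<in> ?R"
    then obtain k1 k2 k3 where "x = of_int k1 *\<^sub>R g1 + of_int k2 *\<^sub>R g2 + of_int k3 *\<^sub>R g3"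
      by blast
    then show "x \<in> ?L"
      by (intro range_eqI[where x = "\<lambda>i. (vector [k1, k2, k3] :: int^3) $ i"]) (simp add: sum_3)
  qed
qed

text \<open>A nonzero determinant excludes both repeated and linearly dependent rows. Repetition
  needs its own argument because independence is stated for the range of the family.\<close>

lemma lattice_basis_triple:
  fixes g1 g2 g3 :: "real^3"
  assumes "det (vector [g1, g2, g3] :: real^3^3) \<noteq> 0"
    and "\<Lambda> = {of_int k1 *\<^sub>R g1 + of_int k2 *\<^sub>R g2 + of_int k3 *\<^sub>R g3 | k1 k2 k3. True}"
  shows "lattice_basis (($) (vector [g1, g2, g3] :: real^3^3)) \<Lambda>"
proof -
  let ?G = "vector [g1, g2, g3] :: real^3^3"
  have "inj (($) ?G)"
  proof (rule injI, rule ccontr)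
    fix i j assume "?G $ i = ?G $ j" "i \<noteq> j"
    then show False
      using assms(1) det_identical_rows[of i j ?G] by (simp add: row_def vec_lambda_eta)
  qed
  moreover have "independent (range (($) ?G))"
    using assms(1) det_dependent_rows[of ?G]
    by (auto simp: rows_def row_def vec_lambda_eta full_SetCompr_eq dependent_vec_eq)
  ultimately show ?thesis
    unfolding lattice_basis_def assms(2) by (simp add: range_triple_combination)
qed

text \<open>The Gram matrix is that of \<open>(-m, m, m), (m, -m, m), (m, m, -m)\<close>.\<close>

lemma body_centred_cubicI:
  fixes g1 g2 g3 :: "real^3"
  assumes \<Lambda>: "\<Lambda> = {of_int k1 *\<^sub>R g1 + of_int k2 *\<^sub>R g2 + of_int k3 *\<^sub>R g3 | k1 k2 k3. True}"
    and m: "m > 0"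
    and diag: "g1 \<bullet> g1 = 3 * m\<^sup>2" "g2 \<bullet> g2 = 3 * m\<^sup>2" "g3 \<bullet> g3 = 3 * m\<^sup>2"
    and off: "g1 \<bullet> g2 = - m\<^sup>2" "g2 \<bullet> g3 = - m\<^sup>2" "g3 \<bullet> g1 = - m\<^sup>2"
  shows "body_centred_cubic \<Lambda>"
proof -
  have off': "g2 \<bullet> g1 = - m\<^sup>2" "g3 \<bullet> g2 = - m\<^sup>2" "g1 \<bullet> g3 = - m\<^sup>2"
    using off by (simp_all add: inner_commute)
  \<comment> \<open>In the model lattice \<open>g2 + g3\<close>, \<open>g3 + g1\<close> and
    \<open>g1 + g2\<close> are \<open>2 * m\<close> times the standard unit vectors. So
    \<open>f\<close> is the candidate isometry from the model to the given lattice.\<close>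
  define h where "h x = x $ 1 *\<^sub>R (g2 + g3) + x $ 2 *\<^sub>R (g3 + g1) + x $ 3 *\<^sub>R (g1 + g2)" for x :: "real^3"
  define f where "f x = (1 / (2 * m)) *\<^sub>R h x" for x
  have lin: "linear f"
    by (rule linearI) (simp_all add: f_def h_def algebra_simps)
  have "f x \<bullet> f x = x \<bullet> x" for x
  proof -
    have xx: "x \<bullet> x = x $ 1 * x $ 1 + x $ 2 * x $ 2 + x $ 3 * x $ 3"
      by (simp add: inner_vec_def sum_3)
    have "h x \<bullet> h x = (2 * m)\<^sup>2 * (x \<bullet> x)"
      unfolding xx h_def
      by (simp add: inner_add_left inner_add_right diag off off' power2_eq_square algebra_simps)
    then show ?thesis
      using m by (simp add: f_def power2_eq_square)
  qed
  then have orth: "orthogonal_transformation f"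
    using lin by (simp add: orthogonal_transformation norm_eq)
  have f_scaled: "(2 * m) *\<^sub>R f x =
      (x $ 2 + x $ 3) *\<^sub>R g1 + (x $ 1 + x $ 3) *\<^sub>R g2 + (x $ 1 + x $ 2) *\<^sub>R g3" for x
    using m by (simp add: f_def h_def algebra_simps)
  have "\<Lambda> = (\<lambda>x. (2 * m) *\<^sub>R f x) ` standard_bcc"
  proof (intro equalityI subsetI)
    fix y assume "y \<in> \<Lambda>"
    then obtain k1 k2 k3 where y: "y = of_int k1 *\<^sub>R g1 + of_int k2 *\<^sub>R g2 + of_int k3 *\<^sub>R g3"
      using \<Lambda> by blast
    \<comment> \<open>This solves \<open>x $ 2 + x $ 3 = k1\<close> and its two analogues. Each
      coordinate is half of \<open>k1 + k2 + k3\<close> minus an integer, so the parity of that sum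
      decides between corners and centres of the cubes.\<close>
    define x :: "real^3" where "x = vector [(of_int k2 + of_int k3 - of_int k1) / 2,
      (of_int k1 + of_int k3 - of_int k2) / 2, (of_int k1 + of_int k2 - of_int k3) / 2]"
    have x: "x $ 1 = (of_int k2 + of_int k3 - of_int k1) / 2"
      "x $ 2 = (of_int k1 + of_int k3 - of_int k2) / 2"
      "x $ 3 = (of_int k1 + of_int k2 - of_int k3) / 2"
      by (simp_all add: x_def)
    have "x $ 2 + x $ 3 = of_int k1" "x $ 1 + x $ 3 = of_int k2" "x $ 1 + x $ 2 = of_int k3"
      unfolding x by argo+
    then have "y = (2 * m) *\<^sub>R f x"
      unfolding f_scaled y by simp
    moreover have "x \<in> standard_bcc"
    proof (cases "even (k1 + k2 + k3)")
      case True
      then obtain n where "k1 + k2 + k3 = 2 * n"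
        by blast
      then have "real_of_int k1 + of_int k2 + of_int k3 = 2 * of_int n"
        by (metis of_int_add of_int_mult of_int_numeral)
      then have "x $ 1 = of_int (n - k1)" "x $ 2 = of_int (n - k2)" "x $ 3 = of_int (n - k3)"
        unfolding x of_int_diff by argo+
      then have "\<forall>i. x $ i \<in> \<int>"
        by (simp add: forall_3)
      then show ?thesis
        by (simp add: standard_bcc_def)
    next
      case False
      then obtain n where "k1 + k2 + k3 = 2 * n + 1"
        by (blast elim: oddE)
      then have "real_of_int k1 + of_int k2 + of_int k3 = 2 * of_int n + 1"
        by (metis of_int_1 of_int_add of_int_mult of_int_numeral)
      then have "x $ 1 - 1 / 2 = of_int (n - k1)" "x $ 2 - 1 / 2 = of_int (n - k2)"
        "x $ 3 - 1 / 2 = of_int (n - k3)"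
        unfolding x of_int_diff by argo+
      then have "\<forall>i. x $ i - 1 / 2 \<in> \<int>"
        unfolding forall_3 by (metis Ints_of_int)
      then show ?thesis
        by (simp add: standard_bcc_def)
    qed
    ultimately show "y \<in> (\<lambda>x. (2 * m) *\<^sub>R f x) ` standard_bcc"
      by blast
  next
    fix y assume "y \<in> (\<lambda>x. (2 * m) *\<^sub>R f x) ` standard_bcc"
    then obtain x where x: "x \<in> standard_bcc" and y: "y = (2 * m) *\<^sub>R f x"
      by blast
    \<comment> \<open>At a cube centre both coordinates are half-integers, and the two shifts by 1/2
      add up to the 1 that is put back.\<close>
    have sum_Int: "x $ i + x $ j \<in> \<int>" for i j
    proof (cases "\<forall>i. x $ i \<in> \<int>")
      case False
      then have "(x $ i - 1/2) + (x $ j - 1/2) + 1 \<in> \<int>"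
        using x unfolding standard_bcc_def by (intro Ints_add) auto
      then show ?thesis
        by simp
    qed simp
    obtain k1 k2 k3 where "x $ 2 + x $ 3 = of_int k1" "x $ 1 + x $ 3 = of_int k2" "x $ 1 + x $ 2 = of_int k3"
      using sum_Int by (meson Ints_cases)
    then show "y \<in> \<Lambda>"
      unfolding y f_scaled \<Lambda> by auto
  qed
  then show ?thesis
    unfolding body_centred_cubic_def using m orth
    by (intro exI[of _ "2 * m"] exI[of _ f]) auto
qed

text \<open>The generators are the triangle vectors of a network all of whose edges have length
  \<open>l\<close>, so this supplies the lattice clause of the equality case.\<close>

lemma body_centred_cubic_K4:
  fixes p q r :: "real^3"
  assumes \<Lambda>: "\<Lambda> = {of_int k1 *\<^sub>R g1 + of_int k2 *\<^sub>R g2 + of_int k3 *\<^sub>R g3 | k1 k2 k3. True}"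
    and unit: "norm p = 1" "norm q = 1" "norm r = 1"
    and angle: "p \<bullet> q = 1 / 2" "q \<bullet> r = 1 / 2" "r \<bullet> p = 1 / 2"
    and l: "l > 0"
    and g: "g1 = l *\<^sub>R (3 *\<^sub>R p - q - r)" "g2 = l *\<^sub>R (3 *\<^sub>R q - p - r)" "g3 = l *\<^sub>R (3 *\<^sub>R r - p - q)"
  shows "body_centred_cubic \<Lambda>"
proof -
  have inners: "q \<bullet> p = 1 / 2" "r \<bullet> q = 1 / 2" "p \<bullet> r = 1 / 2"
    "p \<bullet> p = 1" "q \<bullet> q = 1" "r \<bullet> r = 1"
    using unit angle by (simp_all add: inner_commute dot_square_norm)
  \<comment> \<open>The vectors in parentheses have squared norm 6 and mutual inner products -2,
    which forces \<open>m\<^sup>2 = 2 * l\<^sup>2\<close>.\<close>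
  show ?thesis
    using l by (intro body_centred_cubicI[OF \<Lambda>, of "sqrt 2 * l"])
      (simp_all add: g inner_diff_left inner_diff_right angle inners power2_eq_square algebra_simps)
qed

section \<open>Networks with complete quotient\<close>

context periodic_network
begin

abbreviation orb :: "'v \<Rightarrow> 'v set" where
  "orb \<equiv> vertex_orbit \<Lambda> act"

abbreviation quotient :: "('v set, ('v \<times> 'v) set) pre_digraph" where
  "quotient \<equiv> quotient_graph N \<Lambda> act"

lemma lattice_zero: "0 \<in> \<Lambda>"
  and lattice_add: "x \<in> \<Lambda> \<Longrightarrow> y \<in> \<Lambda> \<Longrightarrow> x + y \<in> \<Lambda>"
  and lattice_uminus: "x \<in> \<Lambda> \<Longrightarrow> - x \<in> \<Lambda>"
proof -
  obtain b where \<Lambda>: "\<Lambda> = range (\<lambda>k :: 'n \<Rightarrow> int. \<Sum>i\<in>UNIV. of_int (k i) *\<^sub>R b i)"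
    using lattice unfolding full_rank_lattice_def lattice_basis_def by blast
  show "0 \<in> \<Lambda>"
    unfolding \<Lambda> by (rule range_eqI[where x = "\<lambda>_. 0"]) simp
  show "x + y \<in> \<Lambda>" if xy: "x \<in> \<Lambda>" "y \<in> \<Lambda>"
  proof -
    obtain k l where "x = (\<Sum>i\<in>UNIV. of_int (k i) *\<^sub>R b i)" "y = (\<Sum>i\<in>UNIV. of_int (l i) *\<^sub>R b i)"
      using xy unfolding \<Lambda> by blast
    then show ?thesis
      unfolding \<Lambda>
      by (intro range_eqI[where x = "\<lambda>i. k i + l i"]) (simp add: scaleR_add_left sum.distrib)
  qed
  show "- x \<in> \<Lambda>" if x: "x \<in> \<Lambda>"
  proof -
    obtain k where "x = (\<Sum>i\<in>UNIV. of_int (k i) *\<^sub>R b i)"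
      using x unfolding \<Lambda> by blast
    then show ?thesis
      unfolding \<Lambda> by (intro range_eqI[where x = "\<lambda>i. - k i"]) (simp add: sum_negf)
  qed
qed

lemma lattice_scale_of_int:
  assumes "x \<in> \<Lambda>"
  shows "of_int k *\<^sub>R x \<in> \<Lambda>"
proof -
  have nat: "of_nat n *\<^sub>R x \<in> \<Lambda>" for n
    by (induction n) (auto simp: scaleR_add_left lattice_zero intro: lattice_add assms)
  then have "- (of_nat n *\<^sub>R x) \<in> \<Lambda>" for n
    by (rule lattice_uminus)
  with nat show ?thesis
    by (cases k rule: int_cases2) auto
qed

lemma orb_act:
  assumes "x \<in> \<Lambda>" "v \<in> pverts N"
  shows "orb (act x v) = orb v"
proof -
  have "act y (act x v) \<in> orb v" if "y \<in> \<Lambda>" for y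
    using that assms unfolding vertex_orbit_def by (metis act_add imageI lattice_add)
  moreover have "act y v \<in> orb (act x v)" if "y \<in> \<Lambda>" for y
  proof -
    have yx: "y - x \<in> \<Lambda>"
      using lattice_add[OF that lattice_uminus[OF assms(1)]] by simp
    then have "act y v = act (y - x) (act x v)"
      using assms by (simp flip: act_add)
    then show ?thesis
      unfolding vertex_orbit_def using yx by blast
  qed
  ultimately show ?thesis
    unfolding vertex_orbit_def by blast
qed

lemma orb_eqD:
  assumes "orb v = orb w" "w \<in> pverts N"
  obtains x where "x \<in> \<Lambda>" "w = act x v"
proof -
  have "w \<in> orb w"
    unfolding vertex_orbit_def using act_zero[OF assms(2)] lattice_zero by force
  then show thesis
    using assms(1) that unfolding vertex_orbit_def by blast
qed

lemma arc_sym: "(u, v) \<in> parcs N \<Longrightarrow> (v, u) \<in> parcs N"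
  using pair_sym_arcs arcs_ends_symmetric[of "with_proj N"] by simp

lemma verts_quotient: "verts quotient = orb ` pverts N"
  and arcs_quotient: "arcs quotient = arc_orbit \<Lambda> act ` parcs N"
  and tail_arc_orbit: "tail quotient (arc_orbit \<Lambda> act (u, v)) = orb u"
  and head_arc_orbit: "head quotient (arc_orbit \<Lambda> act (u, v)) = orb v"
  by (simp_all add: quotient_graph_def arc_orbit_def vertex_orbit_def image_image)

text \<open>
  The \<open>\<tau>\<close>-corrected displacement is additive along walks, and a walk from \<open>v\<close> to its translate
  by \<open>x\<close> has corrected displacement \<open>x\<close>.
\<close>

lemma lattice_subset_of_potential:
  assumes zero: "0 \<in> M" and add: "\<And>x y. x \<in> M \<Longrightarrow> y \<in> M \<Longrightarrow> x + y \<in> M"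
    and arc: "\<And>u w. (u, w) \<in> parcs N \<Longrightarrow> \<tau> (orb u) + (pos w - pos u) - \<tau> (orb w) \<in> M"
  shows "\<Lambda> \<subseteq> M"
proof
  fix x assume x: "x \<in> \<Lambda>"
  \<comment> \<open>Connectedness is defined as strong connectedness of the symmetric closure, which
    adds no arcs to a bidirected graph.\<close>
  let ?S = "mk_symmetric (with_proj N)"
  have ends: "parcs ?S = parcs N"
    unfolding mk_symmetric_def by (auto intro: arc_sym)
  have sc: "strongly_connected (with_proj ?S)"
    using connected_graph unfolding Digraph_Component.connected_def .
  then obtain v where v: "v \<in> pverts N"
    unfolding strongly_connected_def mk_symmetric_def by auto
  interpret S: pair_wf_digraph ?S
    using ends arc_fst_in_verts arc_snd_in_verts
    by unfold_locales (auto simp: mk_symmetric_def intro: in_arcsD1 in_arcsD2)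
  have "v \<rightarrow>\<^sup>*\<^bsub>with_proj ?S\<^esub> act x v"
    using sc v act_verts[OF x v] unfolding strongly_connected_def by (simp add: mk_symmetric_def)
  then have "\<tau> (orb v) + (pos (act x v) - pos v) - \<tau> (orb (act x v)) \<in> M"
  proof (induction rule: S.reachable_induct)
    case base
    then show ?case
      by (simp add: zero)
  next
    case (step y z)
    then have "(y, z) \<in> parcs N"
      by (simp add: ends)
    from add[OF step.IH arc[OF this]] show ?case
      by (simp add: algebra_simps)
  qed
  then show "x \<in> M"
    using x v by (simp add: orb_act pos_act)
qed

end

section \<open>Displacements between vertex orbits over a complete quotient\<close>

locale complete_quotient_network = periodic_network N pos \<Lambda> act
  for N :: "'v pair_pre_digraph" and pos :: "'v \<Rightarrow> real^'n::finite"
    and \<Lambda> :: "(real^'n) set" and act :: "real^'n \<Rightarrow> 'v \<Rightarrow> 'v" +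
  fixes n :: nat
  assumes complete_quotient: "complete_digraph n (quotient_graph N \<Lambda> act)"
begin

lemma graph_quotient: "graph quotient"
  and card_verts_quotient: "card (verts quotient) = n"
  and arcs_ends_quotient:
    "arcs_ends quotient = {(P, R). P \<in> verts quotient \<and> R \<in> verts quotient \<and> P \<noteq> R}"
  using complete_quotient unfolding complete_digraph_def by auto

lemma arc_orb:
  assumes "(u, w) \<in> parcs N"
  shows "orb u \<in> verts quotient" "orb w \<in> verts quotient" "orb u \<noteq> orb w"
proof -
  interpret Q: graph quotient
    by (rule graph_quotient)
  show "orb u \<in> verts quotient" "orb w \<in> verts quotient"
    using assms by (auto simp: verts_quotient intro: in_arcsD1 in_arcsD2)
  show "orb u \<noteq> orb w"
    using Q.no_loops[of "arc_orbit \<Lambda> act (u, w)"] assms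
    by (simp add: arcs_quotient tail_arc_orbit head_arc_orbit)
qed

text \<open>The quotient has no parallel arcs, so arcs joining the same vertex orbits form a single
  arc orbit, and one translation moves both end points.\<close>

lemma arc_translate:
  assumes "(u, w) \<in> parcs N" "(u', w') \<in> parcs N" "orb u = orb u'" "orb w = orb w'"
  obtains x where "x \<in> \<Lambda>" "u' = act x u" "w' = act x w"
proof -
  interpret Q: graph quotient
    by (rule graph_quotient)
  have "arc_orbit \<Lambda> act (u, w) = arc_orbit \<Lambda> act (u', w')"
    using assms
    by (intro Q.no_multi_arcs) (auto simp: arcs_quotient tail_arc_orbit head_arc_orbit arc_to_ends_def)
  moreover have "(u', w') \<in> arc_orbit \<Lambda> act (u', w')"
    using in_arcsD1[OF assms(2)] in_arcsD2[OF assms(2)] lattice_zero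
    unfolding arc_orbit_def by (intro image_eqI[where x = 0]) (simp_all add: act_zero)
  ultimately have "(u', w') \<in> arc_orbit \<Lambda> act (u, w)"
    by simp
  then show thesis
    using that unfolding arc_orbit_def by auto
qed

text \<open>Completeness yields some arc between the two orbits; a translation brings its tail to
  \<open>v\<close>.\<close>

lemma ex_arc:
  assumes "v \<in> pverts N" "P \<in> verts quotient" "orb v \<noteq> P"
  obtains w where "(v, w) \<in> parcs N" "orb w = P"
proof -
  have "(orb v, P) \<in> arcs_ends quotient"
    using assms by (simp add: arcs_ends_quotient verts_quotient)
  then obtain u w where uw: "(u, w) \<in> parcs N" "orb u = orb v" "orb w = P"
    unfolding arcs_ends_conv by (force simp: arcs_quotient tail_arc_orbit head_arc_orbit)
  obtain x where x: "x \<in> \<Lambda>" "v = act x u"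
    using orb_eqD[OF uw(2) assms(1)] .
  show thesis
  proof (rule that)
    show "(v, act x w) \<in> parcs N"
      using act_arcs[OF x(1) uw(1)] x(2) by simp
    show "orb (act x w) = P"
      using orb_act[OF x(1) in_arcsD2[OF uw(1)]] uw(3) by simp
  qed
qed

text \<open>Well defined for distinct vertices of the quotient: all arcs over such a pair are
  translates of each other, and translation preserves differences of positions.\<close>

definition disp :: "'v set \<Rightarrow> 'v set \<Rightarrow> real^'n" where
  "disp P R = (THE d. \<exists>u w. (u, w) \<in> parcs N \<and> orb u = P \<and> orb w = R \<and> d = pos w - pos u)"

lemma disp_orb:
  assumes "(u, w) \<in> parcs N"
  shows "disp (orb u) (orb w) = pos w - pos u"
  unfolding disp_def
proof (rule the_equality)
  fix d assume "\<exists>u' w'. (u', w') \<in> parcs N \<and> orb u' = orb u \<and> orb w' = orb w \<and> d = pos w' - pos u'"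
  then obtain u' w' where *: "(u', w') \<in> parcs N" "orb u' = orb u" "orb w' = orb w" "d = pos w' - pos u'"
    by blast
  then obtain x where "x \<in> \<Lambda>" "u' = act x u" "w' = act x w"
    using arc_translate[OF assms *(1)] by metis
  then show "d = pos w - pos u"
    using *(4) in_arcsD1[OF assms] in_arcsD2[OF assms] by (simp add: pos_act)
qed (use assms in blast)

lemma disp_arcE:
  assumes "P \<in> verts quotient" "R \<in> verts quotient" "P \<noteq> R"
  obtains u w where "(u, w) \<in> parcs N" "P = orb u" "R = orb w" "disp P R = pos w - pos u"
proof -
  obtain u where "u \<in> pverts N" "P = orb u"
    using assms(1) unfolding verts_quotient by blast
  then show thesis
    using ex_arc[of u R] assms that disp_orb by metis
qed

lemma disp_swap:
  assumes "P \<in> verts quotient" "R \<in> verts quotient" "P \<noteq> R"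
  shows "disp R P = - disp P R"
  using disp_arcE[OF assms] disp_orb[OF arc_sym] by (metis minus_diff_eq)

lemma norm_disp_orb:
  assumes "(u, w) \<in> parcs N"
  shows "norm (disp (orb u) (orb w)) = edge_length pos (u, w)"
  using disp_orb[OF assms] by (simp add: edge_length_def dist_norm norm_minus_commute)

lemma norm_disp_pos:
  assumes "P \<in> verts quotient" "R \<in> verts quotient" "P \<noteq> R"
  shows "norm (disp P R) > 0"
  using disp_arcE[OF assms] norm_disp_orb pos_edge_length by metis

text \<open>Injectivity holds because a translation fixing \<open>v\<close> must be zero, by
  equivariance of \<open>pos\<close>. The bijection carries the balancing condition at
  \<open>v\<close> over to the quotient.\<close>

lemma bij_betw_neighbours:
  assumes "v \<in> pverts N"
  shows "bij_betw orb {w. (v, w) \<in> parcs N} (verts quotient - {orb v})"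
proof (rule bij_betw_imageI)
  show "inj_on orb {w. (v, w) \<in> parcs N}"
  proof (rule inj_onI, safe)
    fix w w' assume *: "(v, w) \<in> parcs N" "(v, w') \<in> parcs N" "orb w = orb w'"
    obtain x where x: "x \<in> \<Lambda>" "v = act x v" "w' = act x w"
      using arc_translate[OF *(1,2) refl *(3)] .
    then have "x = 0"
      using pos_act[OF x(1) assms] by simp
    then show "w = w'"
      using x(3) act_zero in_arcsD2[OF *(1)] by simp
  qed
  show "orb ` {w. (v, w) \<in> parcs N} = verts quotient - {orb v}"
  proof (intro equalityI subsetI)
    fix P assume "P \<in> verts quotient - {orb v}"
    then obtain w where "(v, w) \<in> parcs N" "orb w = P"
      using ex_arc[OF assms, of P] by blast
    then show "P \<in> orb ` {w. (v, w) \<in> parcs N}"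
      by blast
  qed (use arc_orb in fastforce)
qed

lemma sum_sgn_disp:
  assumes "steiner_network N pos \<Lambda> act" "P \<in> verts quotient"
  shows "(\<Sum>R\<in>verts quotient - {P}. sgn (disp P R)) = 0"
proof -
  obtain v where v: "v \<in> pverts N" "P = orb v"
    using assms(2) unfolding verts_quotient by blast
  have "(\<Sum>R\<in>verts quotient - {P}. sgn (disp P R)) = (\<Sum>w | (v, w) \<in> parcs N. sgn (disp P (orb w)))"
    unfolding v(2) by (rule sum.reindex_bij_betw[OF bij_betw_neighbours[OF v(1)], symmetric])
  also have "\<dots> = (\<Sum>w | (v, w) \<in> parcs N. sgn (pos w - pos v))"
    unfolding v(2) by (rule sum.cong) (simp_all add: disp_orb)
  also have "\<dots> = 0"
    using steiner_network.balanced[OF assms(1) v(1)] .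
  finally show ?thesis .
qed

text \<open>The triangle lifts to a path in the network whose ends \<open>u\<close> and
  \<open>z\<close> lie in one orbit, hence differ by a lattice vector.\<close>

lemma triangle_in_lattice:
  assumes "P \<in> verts quotient" "R \<in> verts quotient" "S \<in> verts quotient"
    and "P \<noteq> R" "R \<noteq> S" "S \<noteq> P"
  shows "disp P R + disp R S + disp S P \<in> \<Lambda>"
proof -
  obtain u v where uv: "(u, v) \<in> parcs N" "P = orb u" "R = orb v" "disp P R = pos v - pos u"
    using disp_arcE assms by metis
  obtain w where w: "(v, w) \<in> parcs N" "orb w = S"
    using ex_arc[of v S] in_arcsD2[OF uv(1)] assms uv by metis
  obtain z where z: "(w, z) \<in> parcs N" "orb z = P"
    using ex_arc[of w P] in_arcsD2[OF w(1)] assms w by metis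
  obtain x where "x \<in> \<Lambda>" "z = act x u"
    using orb_eqD[of u z] z in_arcsD2[OF z(1)] uv(2) by metis
  moreover have "disp P R + disp R S + disp S P = pos z - pos u"
    using uv disp_orb[OF w(1)] disp_orb[OF z(1)] w(2) z(2) by simp
  ultimately show ?thesis
    using pos_act in_arcsD1[OF uv(1)] by simp
qed

text \<open>Without parallel arcs, the arcs of the complete quotient correspond to the ordered pairs
  of distinct vertices.\<close>

lemma quotient_length_disp:
  "quotient_length N pos \<Lambda> act =
     (\<Sum>(P, R) | P \<in> verts quotient \<and> R \<in> verts quotient \<and> P \<noteq> R. norm (disp P R)) / 2"
proof -
  interpret Q: graph quotient
    by (rule graph_quotient)
  have "bij_betw (arc_to_ends quotient) (arcs quotient) (arcs_ends quotient)"
    unfolding arcs_ends_def using Q.no_multi_arcs by (intro bij_betw_imageI inj_onI) auto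
  then have "(\<Sum>(P, R)\<in>arcs_ends quotient. norm (disp P R)) =
      (\<Sum>a\<in>arcs quotient. case arc_to_ends quotient a of (P, R) \<Rightarrow> norm (disp P R))"
    by (rule sum.reindex_bij_betw[symmetric])
  also have "\<dots> = (\<Sum>a\<in>arcs quotient. the_elem (edge_length pos ` a))"
  proof (rule sum.cong)
    fix a assume "a \<in> arcs quotient"
    then obtain u w where a: "a = arc_orbit \<Lambda> act (u, w)" "(u, w) \<in> parcs N"
      unfolding arcs_quotient by force
    then show "(case arc_to_ends quotient a of (P, R) \<Rightarrow> norm (disp P R)) = the_elem (edge_length pos ` a)"
      by (simp add: arc_to_ends_def tail_arc_orbit head_arc_orbit edge_length_orbit norm_disp_orb)
  qed simp
  finally show ?thesis
    unfolding quotient_length_def arcs_ends_quotient by simp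
qed

text \<open>Rewriting with these equations orients the edges: cyclically around \<open>P\<close>,
  \<open>R\<close>, \<open>S\<close>, and otherwise towards \<open>T\<close>.\<close>

lemma disp_swap_four:
  assumes verts: "verts quotient = {P, R, S, T}" and dist: "distinct [P, R, S, T]"
  shows "disp R P = - disp P R" "disp S R = - disp R S" "disp P S = - disp S P"
    "disp T P = - disp P T" "disp T R = - disp R T" "disp T S = - disp S T"
proof -
  have ne: "P \<noteq> R" "P \<noteq> S" "P \<noteq> T" "R \<noteq> S" "R \<noteq> T" "S \<noteq> T"
    using dist by simp_all
  show "disp R P = - disp P R" "disp S R = - disp R S" "disp P S = - disp S P"
    "disp T P = - disp P T" "disp T R = - disp R T" "disp T S = - disp S T"
    by (rule disp_swap; simp add: verts ne ne[symmetric])+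
qed

text \<open>These are the fundamental cycles of the star at \<open>T\<close>. Corrected by the
  potential \<tau>, an arc of the star has displacement 0 and any other arc gives plus or minus one
  generator, so the generators span the whole lattice.\<close>

lemma lattice_eq_triangles:
  assumes verts: "verts quotient = {P, R, S, T}" and dist: "distinct [P, R, S, T]"
  defines "g1 \<equiv> disp T P + disp P R + disp R T"
    and "g2 \<equiv> disp T R + disp R S + disp S T"
    and "g3 \<equiv> disp T S + disp S P + disp P T"
  shows "\<Lambda> = {of_int k1 *\<^sub>R g1 + of_int k2 *\<^sub>R g2 + of_int k3 *\<^sub>R g3 | k1 k2 k3. True}"
proof -
  have ne: "P \<noteq> R" "P \<noteq> S" "P \<noteq> T" "R \<noteq> S" "R \<noteq> T" "S \<noteq> T"
    using dist by simp_all
  define M where "M = {of_int k1 *\<^sub>R g1 + of_int k2 *\<^sub>R g2 + of_int k3 *\<^sub>R g3 | k1 k2 k3. True}"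
  have M: "of_int k1 *\<^sub>R g1 + of_int k2 *\<^sub>R g2 + of_int k3 *\<^sub>R g3 \<in> M" for k1 k2 k3
    unfolding M_def by blast
  have ME: thesis
    if "x \<in> M" "\<And>k1 k2 k3. x = of_int k1 *\<^sub>R g1 + of_int k2 *\<^sub>R g2 + of_int k3 *\<^sub>R g3 \<Longrightarrow> thesis" for x thesis
    using that unfolding M_def by blast
  have "M \<subseteq> \<Lambda>"
  proof
    fix x assume "x \<in> M"
    then obtain k1 k2 k3 where x: "x = of_int k1 *\<^sub>R g1 + of_int k2 *\<^sub>R g2 + of_int k3 *\<^sub>R g3"
      by (rule ME)
    have "g1 \<in> \<Lambda>" "g2 \<in> \<Lambda>" "g3 \<in> \<Lambda>"
      unfolding g1_def g2_def g3_def
      by (rule triangle_in_lattice; simp add: verts ne ne[symmetric])+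
    then show "x \<in> \<Lambda>"
      unfolding x by (intro lattice_add lattice_scale_of_int)
  qed
  \<comment> \<open>displacements along the spanning star with centre \<open>T\<close>\<close>
  define \<tau> where "\<tau> X = (if X = T then 0 else disp T X)" for X
  have "\<Lambda> \<subseteq> M"
  proof (rule lattice_subset_of_potential[where \<tau> = \<tau>])
    show "0 \<in> M"
      using M[of 0 0 0] by simp
    show "x + y \<in> M" if x: "x \<in> M" and y: "y \<in> M" for x y
    proof -
      obtain k1 k2 k3 where "x = of_int k1 *\<^sub>R g1 + of_int k2 *\<^sub>R g2 + of_int k3 *\<^sub>R g3"
        using x by (rule ME)
      moreover obtain l1 l2 l3 where "y = of_int l1 *\<^sub>R g1 + of_int l2 *\<^sub>R g2 + of_int l3 *\<^sub>R g3"
        using y by (rule ME)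
      ultimately have "x + y = of_int (k1 + l1) *\<^sub>R g1 + of_int (k2 + l2) *\<^sub>R g2 + of_int (k3 + l3) *\<^sub>R g3"
        by (simp add: algebra_simps)
      then show ?thesis
        using M by metis
    qed
    show "\<tau> (orb u) + (pos w - pos u) - \<tau> (orb w) \<in> M" if uw: "(u, w) \<in> parcs N" for u w
    proof -
      have "0 \<in> M" "g1 \<in> M" "g2 \<in> M" "g3 \<in> M" "- g1 \<in> M" "- g2 \<in> M" "- g3 \<in> M"
        using M[of 0 0 0] M[of 1 0 0] M[of 0 1 0] M[of 0 0 1] M[of "-1" 0 0] M[of 0 "-1" 0] M[of 0 0 "-1"]
        by simp_all
      moreover have "\<tau> P + disp P R - \<tau> R = g1" "\<tau> R + disp R P - \<tau> P = - g1"
        "\<tau> R + disp R S - \<tau> S = g2" "\<tau> S + disp S R - \<tau> R = - g2"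
        "\<tau> S + disp S P - \<tau> P = g3" "\<tau> P + disp P S - \<tau> S = - g3"
        "\<tau> T + disp T P - \<tau> P = 0" "\<tau> P + disp P T - \<tau> T = 0"
        "\<tau> T + disp T R - \<tau> R = 0" "\<tau> R + disp R T - \<tau> T = 0"
        "\<tau> T + disp T S - \<tau> S = 0" "\<tau> S + disp S T - \<tau> T = 0"
        using dist by (simp_all add: \<tau>_def g1_def g2_def g3_def disp_swap_four[OF verts dist])
      ultimately have "\<tau> X + disp X Y - \<tau> Y \<in> M"
        if "X \<in> {P, R, S, T}" "Y \<in> {P, R, S, T}" "X \<noteq> Y" for X Y
        using that by (elim insertE emptyE) (simp_all only:)
      then show ?thesis
        using arc_orb[OF uw] disp_orb[OF uw] unfolding verts by metis
    qed
  qed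
  with \<open>M \<subseteq> \<Lambda>\<close> show ?thesis
    unfolding M_def by (rule subset_antisym[rotated])
qed

lemma quotient_length_four:
  assumes verts: "verts quotient = {P, R, S, T}" and dist: "distinct [P, R, S, T]"
  shows "quotient_length N pos \<Lambda> act =
    norm (disp P R) + norm (disp R S) + norm (disp S P) +
    norm (disp S T) + norm (disp P T) + norm (disp R T)"
  unfolding quotient_length_disp verts sum_ordered_pairs_of_four[OF dist] disp_swap_four[OF verts dist]
  by simp

lemma all_edge_lengths_iff:
  "(\<forall>e\<in>parcs N. edge_length pos e = l) \<longleftrightarrow>
    (\<forall>P\<in>verts quotient. \<forall>R\<in>verts quotient. P \<noteq> R \<longrightarrow> norm (disp P R) = l)" (is "?E \<longleftrightarrow> ?D")
proof
  assume ?E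
  then show ?D
    using norm_disp_orb disp_arcE by metis
next
  assume ?D
  then have "edge_length pos (u, w) = l" if "(u, w) \<in> parcs N" for u w
    using that arc_orb norm_disp_orb by metis
  then show ?E
    by auto
qed

end

section \<open>Steiner networks over K_4\<close>

text \<open>The volume enters as the determinant of an explicit basis, the three triangles through
  \<open>T\<close>; independence of the basis then turns it into \<open>covolume\<close>.\<close>

lemma steiner_K4_basis:
  fixes N :: "'v pair_pre_digraph" and pos :: "'v \<Rightarrow> real^3"
  assumes steiner: "steiner_network N pos \<Lambda> act"
    and K4: "complete_digraph 4 (quotient_graph N \<Lambda> act)"
    and L: "L = quotient_length N pos \<Lambda> act"
  shows "\<exists>b. lattice_basis b \<Lambda> \<and> L ^ 3 / \<bar>det (\<chi> i. b i)\<bar> \<ge> 27 / sqrt 2 \<and>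
    (L ^ 3 / \<bar>det (\<chi> i. b i)\<bar> = 27 / sqrt 2 \<longleftrightarrow>
      (\<forall>e\<in>parcs N. \<forall>e'\<in>parcs N. edge_length pos e = edge_length pos e') \<and>
      body_centred_cubic \<Lambda>)"
proof -
  interpret complete_quotient_network N pos \<Lambda> act 4
    using steiner K4
    by (simp add: complete_quotient_network_def complete_quotient_network_axioms_def steiner_network_def)
  obtain P R S T where verts: "verts quotient = {P, R, S, T}" and dist: "distinct [P, R, S, T]"
  proof -
    have "card (verts quotient) = Suc 3"
      using card_verts_quotient by simp
    then obtain T A where T: "verts quotient = insert T A" "T \<notin> A" "card A = 3"
      unfolding card_Suc_eq by blast
    moreover obtain P R S where "A = {P, R, S}" "P \<noteq> R" "R \<noteq> S" "P \<noteq> S"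
      using T(3) unfolding card_3_iff by blast
    ultimately show thesis
      by (intro that[of P R S T]) auto
  qed
  have ne: "P \<noteq> R" "P \<noteq> S" "P \<noteq> T" "R \<noteq> S" "R \<noteq> T" "S \<noteq> T"
    using dist by simp_all
  define p q r where u: "p = sgn (disp P R)" "q = sgn (disp R S)" "r = sgn (disp S P)"
  \<comment> \<open>Primed lengths belong to the opposite edges: those from \<open>S\<close>,
    \<open>P\<close> and \<open>R\<close> to the fourth vertex \<open>T\<close>.\<close>
  define a b c a' b' c' where l: "a = norm (disp P R)" "b = norm (disp R S)" "c = norm (disp S P)"
    "a' = norm (disp S T)" "b' = norm (disp P T)" "c' = norm (disp R T)"
  have lpos: "a > 0" "b > 0" "c > 0" "a' > 0" "b' > 0" "c' > 0"
    unfolding l by (rule norm_disp_pos; simp add: verts ne ne[symmetric])+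
  note swap = disp_swap_four[OF verts dist]
  have "verts quotient - {P} = {R, S, T}" "verts quotient - {R} = {P, S, T}"
    "verts quotient - {S} = {P, R, T}"
    unfolding verts using ne by (simp_all add: insert_Diff_if ne[symmetric])
  then have "sgn (disp P R) + sgn (disp P S) + sgn (disp P T) = 0"
    "sgn (disp R P) + sgn (disp R S) + sgn (disp R T) = 0"
    "sgn (disp S P) + sgn (disp S R) + sgn (disp S T) = 0"
    using sum_sgn_disp[OF steiner, of P] sum_sgn_disp[OF steiner, of R] sum_sgn_disp[OF steiner, of S]
      verts dist by (simp_all add: add_ac)
  then have balance: "p + (- r) + sgn (disp P T) = 0" "(- p) + q + sgn (disp R T) = 0"
    "(- q) + r + sgn (disp S T) = 0"
    unfolding u swap by (simp_all add: sgn_minus add_ac)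
  have unit: "norm p = 1" "norm q = 1" "norm r = 1" "norm (sgn (disp P T)) = 1"
    "norm (sgn (disp R T)) = 1" "norm (sgn (disp S T)) = 1"
    using lpos unfolding u l by (simp_all add: norm_sgn)
  \<comment> \<open>In the cyclic orientation one of the two triangle edges at each vertex points
    inwards. Its minus sign turns the 120 degrees of the balancing condition into 60.\<close>
  have angle: "p \<bullet> q = 1 / 2" "q \<bullet> r = 1 / 2" "r \<bullet> p = 1 / 2"
    using inner_balanced_units[OF _ _ _ balance(1)] inner_balanced_units[OF _ _ _ balance(2)]
      inner_balanced_units[OF _ _ _ balance(3)] unit by (simp_all add: inner_commute)
  have "sgn (disp P T) = r - p" "sgn (disp R T) = p - q" "sgn (disp S T) = q - r"
    using balance by (simp_all add: add_eq_0_iff)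
  moreover have "x = norm x *\<^sub>R sgn x" for x :: "real^3"
    by (cases "x = 0") (simp_all add: sgn_div_norm)
  ultimately have disp: "disp P R = a *\<^sub>R p" "disp R S = b *\<^sub>R q" "disp S P = c *\<^sub>R r"
    "disp P T = b' *\<^sub>R (r - p)" "disp R T = c' *\<^sub>R (p - q)" "disp S T = a' *\<^sub>R (q - r)"
    unfolding u l by metis+
  let ?g1 = "(a + b' + c') *\<^sub>R p - c' *\<^sub>R q - b' *\<^sub>R r"
    and ?g2 = "(b + c' + a') *\<^sub>R q - c' *\<^sub>R p - a' *\<^sub>R r"
    and ?g3 = "(c + a' + b') *\<^sub>R r - b' *\<^sub>R p - a' *\<^sub>R q"
    and ?K = "K4_trees a b c a' b' c'"
  have "disp T P + disp P R + disp R T = ?g1" "disp T R + disp R S + disp S T = ?g2"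
    "disp T S + disp S P + disp P T = ?g3"
    unfolding swap disp by (simp_all add: algebra_simps)
  then have \<Lambda>: "\<Lambda> = {of_int k1 *\<^sub>R ?g1 + of_int k2 *\<^sub>R ?g2 + of_int k3 *\<^sub>R ?g3 | k1 k2 k3. True}"
    using lattice_eq_triangles[OF verts dist] by simp
  have K: "?K > 0"
    using K4_trees_pos lpos by blast
  have "sqrt ((det (vector [p, q, r] :: real^3^3))\<^sup>2) = sqrt (1 / 2)"
    using det_rows_squared[OF unit(1-3) angle] by (rule arg_cong)
  then have "\<bar>det (vector [p, q, r] :: real^3^3)\<bar> = 1 / sqrt 2"
    by (simp add: real_sqrt_divide)
  then have abs_det: "\<bar>det (vector [?g1, ?g2, ?g3] :: real^3^3)\<bar> = ?K / sqrt 2"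
    unfolding det_K4_cycles using K by (simp add: abs_mult)
  then have basis: "lattice_basis (($) (vector [?g1, ?g2, ?g3] :: real^3^3)) \<Lambda>"
    using K by (intro lattice_basis_triple[OF _ \<Lambda>]) auto
  define V where "V = \<bar>det (vector [?g1, ?g2, ?g3] :: real^3^3)\<bar>"
  have V_eq: "V = ?K / sqrt 2"
    unfolding V_def by (rule abs_det)
  have L_eq: "L = a + b + c + a' + b' + c'"
    unfolding L l by (rule quotient_length_four[OF verts dist])
  have ratio: "L ^ 3 / V - 27 / sqrt 2 = (2 * L ^ 3 - 27 * ?K) / (sqrt 2 * ?K)"
  proof -
    \<comment> \<open>Stated for general \<open>s\<close>; for \<open>s = sqrt 2\<close> the product
      \<open>s * s\<close> becomes the factor 2. The denominator is positive, so the numerator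
      decides both the inequality and equality.\<close>
    have "x / (k / s) - 27 / s = (s * s * x - 27 * k) / (s * k)"
      if "k \<noteq> 0" "s \<noteq> 0" for x k s :: real
      using that by (simp add: field_simps)
    from this[of ?K "sqrt 2" "L ^ 3"] show ?thesis
      unfolding V_eq using K by simp
  qed
  have all_eq_iff: "(\<forall>e\<in>parcs N. \<forall>e'\<in>parcs N. edge_length pos e = edge_length pos e') \<longleftrightarrow>
      a = b \<and> b = c \<and> c = a' \<and> a' = b' \<and> b' = c'" (is "?E \<longleftrightarrow> ?A")
  proof -
    \<comment> \<open>An actual arc over \<open>P\<close> and \<open>R\<close> serves as reference:
      all lengths agree exactly when they all equal \<open>a\<close>.\<close>
    have "P \<in> verts quotient" "R \<in> verts quotient" "P \<noteq> R"
      unfolding verts using dist by simp_all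
    then obtain u w where uw: "(u, w) \<in> parcs N" "P = orb u" "R = orb w"
      using disp_arcE by metis
    have "?E \<longleftrightarrow> (\<forall>e\<in>parcs N. edge_length pos e = a)"
      using uw norm_disp_orb[OF uw(1)] unfolding l by metis
    also have "\<dots> \<longleftrightarrow> ?A"
      unfolding all_edge_lengths_iff verts using ne by (simp add: swap l ne[symmetric]) metis
    finally show ?thesis .
  qed
  have "27 / sqrt 2 \<le> L ^ 3 / V"
  proof -
    have "0 \<le> L ^ 3 / V - 27 / sqrt 2"
      unfolding ratio using K4_trees_le(1)[OF lpos] K by (simp add: L_eq)
    then show ?thesis
      by simp
  qed
  moreover have "L ^ 3 / V = 27 / sqrt 2 \<longleftrightarrow> ?A"
  proof -
    have "L ^ 3 / V = 27 / sqrt 2 \<longleftrightarrow> 27 * ?K = 2 * L ^ 3"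
      using ratio K by auto
    also have "\<dots> \<longleftrightarrow> ?A"
    proof
      assume ?A
      then have "b = a" "c = a" "a' = a" "b' = a" "c' = a"
        by auto
      \<comment> \<open>For equal weights \<open>?K\<close> is \<open>16 * a ^ 3\<close>, one term
        per spanning tree, and \<open>L\<close> is \<open>6 * a\<close>; both sides are
        \<open>432 * a ^ 3\<close>.\<close>
      then show "27 * ?K = 2 * L ^ 3"
        by (simp add: L_eq K4_trees_def power3_eq_cube)
    qed (use K4_trees_le(2)[OF lpos] L_eq in simp)
    finally show ?thesis .
  qed
  moreover have "body_centred_cubic \<Lambda>" if ?A
  proof (rule body_centred_cubic_K4[OF \<Lambda> unit(1-3) angle lpos(1)])
    have eq: "b = a" "c = a" "a' = a" "b' = a" "c' = a"
      using that by auto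
    show "?g1 = a *\<^sub>R (3 *\<^sub>R p - q - r)" "?g2 = a *\<^sub>R (3 *\<^sub>R q - p - r)" "?g3 = a *\<^sub>R (3 *\<^sub>R r - p - q)"
      unfolding eq by (simp_all add: algebra_simps flip: scaleR_add_left)
  qed
  ultimately show ?thesis
    using basis unfolding all_eq_iff V_def
    by (intro exI[of _ "($) (vector [?g1, ?g2, ?g3] :: real^3^3)"]) (simp only: vec_lambda_eta, blast)
qed

theorem theorem6p3:
  fixes N :: "'v pair_pre_digraph"
    and pos :: "'v \<Rightarrow> real^3"
    and \<Lambda> :: "(real^3) set"
    and act :: "real^3 \<Rightarrow> 'v \<Rightarrow> 'v"
    and L V :: real
  assumes steiner: "steiner_network N pos \<Lambda> act"
    and K4: "complete_digraph 4 (quotient_graph N \<Lambda> act)"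
    and L: "L = quotient_length N pos \<Lambda> act"
    and V: "V = covolume \<Lambda>"
  shows "L ^ 3 / V \<ge> 27 / sqrt 2 \<and>
    (L ^ 3 / V = 27 / sqrt 2 \<longleftrightarrow>
      (\<forall>e\<in>parcs N. \<forall>e'\<in>parcs N. edge_length pos e = edge_length pos e') \<and>
      body_centred_cubic \<Lambda>)"
proof -
  obtain b where "lattice_basis b \<Lambda>" and main: "27 / sqrt 2 \<le> L ^ 3 / \<bar>det (\<chi> i. b i)\<bar> \<and>
    (L ^ 3 / \<bar>det (\<chi> i. b i)\<bar> = 27 / sqrt 2 \<longleftrightarrow>
      (\<forall>e\<in>parcs N. \<forall>e'\<in>parcs N. edge_length pos e = edge_length pos e') \<and>
      body_centred_cubic \<Lambda>)"
    using steiner_K4_basis[OF steiner K4 L] by blast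
  then have "V = \<bar>det (\<chi> i. b i)\<bar>"
    using V covolume_eq by simp
  with main show ?thesis
    by simp
qed

end
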